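(* Let $M=(m_{ij})$ be a $3\times 3$ matrix with nonnegative integer entries, total sum of entries $6$, and $D_\pi(M)=2$ for all $\pi\in S_3$, where $D_\pi(M)=\sum_{i=1}^3 m_{i\pi(i)}$. Let $R_i$ and $C_j$ denote the row and column sums of $M$. Then $m_{ij}=\frac{R_i+C_j-2}{3}$ for all $i,j$; the $R_i$ are all congruent to each other modulo $3$, and likewise the $C_j$ are all congruent to each other modulo $3$; and $M$ is, up to row and column permutations, one of the five matrices \[ \begin{pmatrix}2&2&2\\0&0&0\\0&0&0\end{pmatrix},\quad \begin{pmatrix}1&1&1\\1&1&1\\0&0&0\end{pmatrix},\quad \begin{pmatrix}0&0&1\\0&0&1\\1&1&2\end{pmatrix},\quad \begin{pmatrix}2&0&0\\2&0&0\\2&0&0\end{pmatrix},\quad \begin{pmatrix}1&1&0\\1&1&0\\1&1&0\end{pmatrix}, \] whose orbits under row and column permutations have sizes $3,3,9,3,3$ respectively; there are exactly $21$ such matrices $M$ in all. In particular, the row-sum vector $(R_1,R_2,R_3)$ is a permutation of $(6,0,0)$, $(3,3,0)$, $(4,1,1)$ or $(2,2,2)$.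
   Context: $S_3$ is the group of permutations of $\{1,2,3\}$; rows and columns may be permuted independently. *)

theory Defs
  imports "HOL-Analysis.Analysis" "HOL-Combinatorics.Permutations" "HOL-Number_Theory.Cong"
begin

text \<open>
  Indices range over the three-element type \<open>3\<close>, whose elements are \<open>1\<close>, \<open>2\<close> and \<open>3 = 0\<close>;
  the library's \<open>vector [x, y, z]\<close> has components \<open>x\<close>, \<open>y\<close>, \<open>z\<close> at \<open>1\<close>, \<open>2\<close>, \<open>3\<close>.
\<close>

definition diag_sum :: "(3 \<Rightarrow> 3) \<Rightarrow> nat ^ 3 ^ 3 \<Rightarrow> nat" where
  "diag_sum p M = (\<Sum>i\<in>UNIV. M $ i $ p i)"

definition row_sum :: "nat ^ 3 ^ 3 \<Rightarrow> 3 \<Rightarrow> nat" where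
  "row_sum M i = (\<Sum>j\<in>UNIV. M $ i $ j)"

definition col_sum :: "nat ^ 3 ^ 3 \<Rightarrow> 3 \<Rightarrow> nat" where
  "col_sum M j = (\<Sum>i\<in>UNIV. M $ i $ j)"

definition admissible :: "nat ^ 3 ^ 3 \<Rightarrow> bool" where
  "admissible M \<longleftrightarrow>
     (\<Sum>i\<in>UNIV. \<Sum>j\<in>UNIV. M $ i $ j) = 6 \<and>
     (\<forall>p. p permutes UNIV \<longrightarrow> diag_sum p M = 2)"

definition row_col_orbit :: "nat ^ 3 ^ 3 \<Rightarrow> (nat ^ 3 ^ 3) set" where
  "row_col_orbit A =
     {(\<chi> i j. A $ p i $ q j) | p q. p permutes UNIV \<and> q permutes UNIV}"

definition vec_perm :: "nat ^ 3 \<Rightarrow> nat ^ 3 \<Rightarrow> bool" where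
  "vec_perm v w \<longleftrightarrow> (\<exists>p. p permutes UNIV \<and> v = (\<chi> i. w $ p i))"

definition A1 :: "nat ^ 3 ^ 3" where
  "A1 = vector [vector [2, 2, 2], vector [0, 0, 0], vector [0, 0, 0]]"

definition A2 :: "nat ^ 3 ^ 3" where
  "A2 = vector [vector [1, 1, 1], vector [1, 1, 1], vector [0, 0, 0]]"

definition A3 :: "nat ^ 3 ^ 3" where
  "A3 = vector [vector [0, 0, 1], vector [0, 0, 1], vector [1, 1, 2]]"

definition A4 :: "nat ^ 3 ^ 3" where
  "A4 = vector [vector [2, 0, 0], vector [2, 0, 0], vector [2, 0, 0]]"

definition A5 :: "nat ^ 3 ^ 3" where
  "A5 = vector [vector [1, 1, 0], vector [1, 1, 0], vector [1, 1, 0]]"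

end

theory Submission
  imports Defs
begin

text \<open>
  Two permutations that differ by a transposition have diagonals that differ only inside a
  \<open>2 \<times> 2\<close> submatrix. If all diagonal sums agree, each \<open>2 \<times> 2\<close> submatrix therefore has equal
  diagonal and antidiagonal sums, which says that \<open>M $ i $ j = a $ i + b $ j\<close>. Subtracting a minimal row makes
  \<open>a\<close> and \<open>b\<close> nonnegative, and every diagonal sum is then \<open>\<Sum>a + \<Sum>b\<close>. So the admissible matrices are
  exactly the outer sums of natural vectors of joint weight \<open>2\<close> (lemma \<open>admissible_iff_outer_sum\<close>):
  one distributes two units over the six lines (rows and columns) of the matrix.

  All claims can be read off from \<open>(a, b)\<close>. The row and column sums are \<open>3 * a $ i + \<Sum>b\<close> and
  \<open>3 * b $ j + \<Sum>a\<close>, which gives the formula for the entries and the congruences.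
  A weight of at most \<open>2\<close> leaves some entry of \<open>a\<close> equal to \<open>0\<close>, and this
  normalisation makes the pair unique (lemma \<open>outer_sum_inject\<close>), so counting matrices is counting
  pairs. Permuting rows and columns permutes \<open>a\<close> and \<open>b\<close> separately, so orbits are products
  of orbits of vectors. The weights \<open>(2, 0)\<close>, \<open>(1, 1)\<close>, \<open>(0, 2)\<close> of \<open>(a, b)\<close> give
  \<open>6 + 9 + 6 = 21\<close> pairs, and up to permutation a vector of weight \<open>2\<close> is \<open>(2, 0, 0)\<close> or
  \<open>(1, 1, 0)\<close>, which yields the five orbits.
\<close>

definition outer_sum :: "nat ^ 3 \<Rightarrow> nat ^ 3 \<Rightarrow> nat ^ 3 ^ 3" where
  "outer_sum a b = (\<chi> i j. a $ i + b $ j)"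

definition weight :: "nat ^ 3 \<Rightarrow> nat" where
  "weight v = (\<Sum>i\<in>UNIV. v $ i)"

text \<open>
  Every vector below has at most two distinct entries, one of them at a single position, so this
  family covers all of them. For \<open>x \<noteq> y\<close> the position \<open>k\<close> labels the orbit of the vector.
\<close>

definition spike :: "nat \<Rightarrow> nat \<Rightarrow> 3 \<Rightarrow> nat ^ 3" where
  "spike x y k = (\<chi> i. if i = k then x else y)"

lemma outer_sum_nth [simp]: "outer_sum a b $ i $ j = a $ i + b $ j"
  by (simp add: outer_sum_def)

lemma row_sum_outer_sum: "row_sum (outer_sum a b) i = 3 * a $ i + weight b"
  by (simp add: row_sum_def weight_def sum_3)

lemma col_sum_outer_sum: "col_sum (outer_sum a b) j = 3 * b $ j + weight a"
  by (simp add: col_sum_def weight_def sum_3)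

text \<open>
  Adding a constant to \<open>a\<close> and removing it from \<open>b\<close> is the only ambiguity, and a zero entry
  in both candidates for \<open>a\<close> excludes it.
\<close>

lemma outer_sum_inject:
  assumes eq: "outer_sum a b = outer_sum a' b'" and zero: "a $ i = 0" "a' $ i' = 0"
  shows "a = a'" "b = b'"
proof -
  have entry: "a $ k + b $ j = a' $ k + b' $ j" for k j
    using arg_cong[OF eq, of "\<lambda>M. M $ k $ j"] by simp
  show b: "b = b'"
  proof (rule vec_eq_iff[THEN iffD2, rule_format])
    fix j show "b $ j = b' $ j"
      using entry[of i j] entry[of i' j] zero by linarith
  qed
  show "a = a'"
    using entry b by (simp add: vec_eq_iff)
qed

lemma zero_entry_if_weight_le_2: "weight a \<le> 2 \<Longrightarrow> \<exists>i. a $ i = 0"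
  by (rule ccontr) (simp add: weight_def sum_3 forall_3)

lemma inj_on_outer_sum:
  "inj_on (\<lambda>(a, b). outer_sum a b) {(a, b). weight a \<le> 2}"
proof (rule inj_onI, clarify)
  fix a b a' b'
  assume eq: "outer_sum a b = outer_sum a' b'" and "weight a \<le> 2" "weight a' \<le> 2"
  then obtain i i' where "a $ i = 0" "a' $ i' = 0"
    using zero_entry_if_weight_le_2 by metis
  then show "a = a' \<and> b = b'"
    using outer_sum_inject[OF eq] by simp
qed

section \<open>Equal diagonal sums force an outer sum\<close>

lemma diag_sum_outer_sum:
  assumes "p permutes UNIV"
  shows "diag_sum p (outer_sum a b) = weight a + weight b"
  using sum.permute[OF assms, of "\<lambda>j. b $ j"]
  by (simp add: diag_sum_def weight_def sum.distrib o_def)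

lemma admissible_exchange:
  assumes "admissible M"
  shows "M $ i $ j + M $ k $ l = M $ i $ l + M $ k $ j"
proof (cases "i = k \<or> j = l")
  case True
  then show ?thesis by auto
next
  case False
  then have ik: "i \<noteq> k" and jl: "j \<noteq> l" by auto
  \<comment> \<open>The first transposition sends \<open>i\<close> to \<open>j\<close>; the second then moves the image of \<open>k\<close> to \<open>l\<close>
    and leaves \<open>j\<close> in place.\<close>
  define p where "p = Transposition.transpose (Transposition.transpose i j k) l \<circ> Transposition.transpose i j"
  define q where "q = p \<circ> Transposition.transpose i k"
  have p: "p permutes UNIV" and q: "q permutes UNIV"
    unfolding p_def q_def by (auto intro!: permutes_compose permutes_swap_id)
  have "Transposition.transpose i j k \<noteq> j"
    using ik by (auto simp: Transposition.transpose_def split: if_splits)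
  then have pi: "p i = j" and pk: "p k = l"
    using jl by (simp_all add: p_def Transposition.transpose_def)
  have qi: "q i = l" and qk: "q k = j"
    using pi pk by (simp_all add: q_def)
  have split: "diag_sum r M = M $ i $ r i + M $ k $ r k + (\<Sum>m\<in>UNIV - {i} - {k}. M $ m $ r m)" for r
    unfolding diag_sum_def using ik
    by (subst sum.remove[of UNIV i], simp, simp, subst sum.remove[of "UNIV - {i}" k]) auto
  have rest: "(\<Sum>m\<in>UNIV - {i} - {k}. M $ m $ p m) = (\<Sum>m\<in>UNIV - {i} - {k}. M $ m $ q m)"
    by (rule sum.cong) (auto simp: q_def Transposition.transpose_def)
  have "diag_sum p M = diag_sum q M"
    using assms p q by (simp add: admissible_def)
  then show ?thesis
    using rest by (simp add: split pi pk qi qk)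
qed

lemma admissible_iff_outer_sum:
  "admissible M \<longleftrightarrow> (\<exists>a b. weight a + weight b = 2 \<and> M = outer_sum a b)"
proof
  assume adm: "admissible M"
  \<comment> \<open>By the exchange property, the row that is minimal in column \<open>1\<close> is minimal in every column.\<close>
  obtain r where r: "\<And>i. M $ r $ 1 \<le> M $ i $ 1"
    using ex_has_least_nat[of "\<lambda>_. True" _ "\<lambda>i. M $ i $ 1"] by blast
  define a where "a = (\<chi> i. M $ i $ 1 - M $ r $ 1)"
  define b where "b = M $ r"
  have M: "M = outer_sum a b"
  proof (simp add: vec_eq_iff a_def b_def, intro allI)
    fix i j
    show "M $ i $ j = M $ i $ 1 - M $ r $ 1 + M $ r $ j"
      using admissible_exchange[OF adm, of i j r 1] r[of i] by linarith
  qed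
  moreover have "weight a + weight b = 2"
    using adm diag_sum_outer_sum[OF permutes_id, of a b] permutes_id
    unfolding admissible_def M by metis
  ultimately show "\<exists>a b. weight a + weight b = 2 \<and> M = outer_sum a b"
    by blast
next
  assume "\<exists>a b. weight a + weight b = 2 \<and> M = outer_sum a b"
  then obtain a b where w: "weight a + weight b = 2" and M: "M = outer_sum a b" by blast
  have "(\<Sum>i\<in>UNIV. \<Sum>j\<in>UNIV. M $ i $ j) = 3 * (weight a + weight b)"
    by (simp add: M weight_def sum_3)
  then show "admissible M"
    using w by (simp add: admissible_def M diag_sum_outer_sum)
qed

section \<open>Orbits of vectors\<close>

text \<open>Any position can be moved to any other one by a transposition.\<close>

lemma vec_perm_spike_iff: "vec_perm v (spike x y k) \<longleftrightarrow> v \<in> range (spike x y)"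
proof
  assume "vec_perm v (spike x y k)"
  then obtain p where p: "p permutes UNIV" and v: "v = (\<chi> i. spike x y k $ p i)"
    by (auto simp: vec_perm_def)
  have "v = spike x y (inv p k)"
    using permutes_inverses[OF p] by (auto simp: v spike_def vec_eq_iff)
  then show "v \<in> range (spike x y)" by blast
next
  assume "v \<in> range (spike x y)"
  then obtain l where v: "v = spike x y l" by blast
  have "v = (\<chi> i. spike x y k $ Transposition.transpose l k i)"
    by (auto simp: v spike_def vec_eq_iff Transposition.transpose_def)
  moreover have "Transposition.transpose l k permutes UNIV"
    by (simp add: permutes_swap_id)
  ultimately show "vec_perm v (spike x y k)"
    unfolding vec_perm_def by blast
qed

lemma card_range_spike:
  assumes "x \<noteq> y"
  shows "card (range (spike x y)) = 3"
proof -
  have "inj (spike x y)"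
    using assms by (intro injI) (auto simp: spike_def vec_eq_iff split: if_splits)
  then show ?thesis by (simp add: card_image)
qed

lemma range_spike_const: "range (spike x x) = {spike x x 1}"
  by (auto simp: spike_def)

lemma weight_spike: "weight (spike x y k) = x + 2 * y"
  using exhaust_3[of k] by (auto simp: weight_def spike_def sum_3)

lemma vec3_eq_iff: "(v :: nat ^ 3) = w \<longleftrightarrow> v $ 1 = w $ 1 \<and> v $ 2 = w $ 2 \<and> v $ 3 = w $ 3"
  by (simp add: vec_eq_iff forall_3)

lemma weight_eq_0_iff: "weight v = 0 \<longleftrightarrow> v \<in> range (spike 0 0)"
  by (auto simp: weight_def spike_def vec_eq_iff)

lemma weight_eq_1_iff: "weight v = 1 \<longleftrightarrow> v \<in> range (spike 1 0)"
proof
  assume "weight v = 1"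
  then have "v = spike 1 0 1 \<or> v = spike 1 0 2 \<or> v = spike 1 0 3"
    by (simp add: weight_def sum_3 vec3_eq_iff spike_def) linarith
  then show "v \<in> range (spike 1 0)" by blast
qed (auto simp: weight_spike)

lemma weight_eq_2_iff: "weight v = 2 \<longleftrightarrow> v \<in> range (spike 2 0) \<union> range (spike 0 1)"
proof
  assume "weight v = 2"
  then have third: "v $ 3 = 2 - v $ 1 - v $ 2" and "v $ 1 + v $ 2 \<le> 2"
    by (simp_all add: weight_def sum_3)
  then have "v $ 1 = 0 \<or> v $ 1 = 1 \<or> v $ 1 = 2" "v $ 2 = 0 \<or> v $ 2 = 1 \<or> v $ 2 = 2"
    "v $ 1 + v $ 2 \<le> 2"
    by linarith+
  with third have "v = spike 2 0 1 \<or> v = spike 2 0 2 \<or> v = spike 2 0 3 \<or>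
      v = spike 0 1 1 \<or> v = spike 0 1 2 \<or> v = spike 0 1 3"
    by (elim disjE) (simp_all add: vec3_eq_iff spike_def)
  then show "v \<in> range (spike 2 0) \<union> range (spike 0 1)" by blast
qed (auto simp: weight_spike)

lemma card_weight_le_2:
  "card {v. weight v = 0} = 1" "card {v. weight v = 1} = 3" "card {v. weight v = 2} = 6"
proof -
  show "card {v. weight v = 0} = 1"
    by (simp add: weight_eq_0_iff range_spike_const)
  show "card {v. weight v = 1} = 3"
    using card_range_spike[of 1 0] by (simp only: weight_eq_1_iff Collect_mem_eq)
  have "spike 2 0 k \<noteq> spike 0 1 l" for k l
    by (auto simp: spike_def vec_eq_iff intro!: exI[of _ k])
  then have "range (spike 2 0) \<inter> range (spike 0 1) = {}" by blast
  then have "card (range (spike 2 0) \<union> range (spike 0 1)) = 3 + 3"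
    by (simp add: card_Un_disjoint card_range_spike)
  then show "card {v. weight v = 2} = 6"
    by (simp only: weight_eq_2_iff Collect_mem_eq)
qed

section \<open>Orbits of matrices\<close>

lemma row_col_orbit_outer_sum:
  "row_col_orbit (outer_sum a b) =
    (\<lambda>(v, w). outer_sum v w) ` ({v. vec_perm v a} \<times> {w. vec_perm w b})"
proof -
  have "(\<chi> i j. outer_sum a b $ p i $ q j) = outer_sum (\<chi> i. a $ p i) (\<chi> j. b $ q j)" for p q
    by (simp add: vec_eq_iff)
  then show ?thesis
    unfolding row_col_orbit_def vec_perm_def by (auto simp: image_iff)
qed

lemma row_col_orbit_spikes:
  "row_col_orbit (outer_sum (spike x y k) (spike x' y' l)) =
    (\<lambda>(v, w). outer_sum v w) ` (range (spike x y) \<times> range (spike x' y'))"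
  by (simp add: row_col_orbit_outer_sum vec_perm_spike_iff)

lemma card_row_col_orbit_spikes:
  assumes "x + 2 * y \<le> 2"
  shows "card (row_col_orbit (outer_sum (spike x y k) (spike x' y' l))) =
    card (range (spike x y)) * card (range (spike x' y'))"
proof -
  have "range (spike x y) \<times> range (spike x' y') \<subseteq> {(a, b). weight a \<le> 2}"
    using assms by (auto simp: weight_spike)
  from card_image[OF inj_on_subset[OF inj_on_outer_sum this]] show ?thesis
    by (simp add: row_col_orbit_spikes card_cartesian_product)
qed

lemma representatives_as_outer_sums:
  "A1 = outer_sum (spike 2 0 1) (spike 0 0 1)"
  "A2 = outer_sum (spike 0 1 3) (spike 0 0 1)"
  "A3 = outer_sum (spike 1 0 3) (spike 1 0 3)"
  "A4 = outer_sum (spike 0 0 1) (spike 2 0 1)"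
  "A5 = outer_sum (spike 0 0 1) (spike 0 1 3)"
  by (simp_all add: A1_def A2_def A3_def A4_def A5_def vec_eq_iff forall_3 spike_def)

lemma card_orbits_of_representatives:
  "card (row_col_orbit A1) = 3" "card (row_col_orbit A2) = 3" "card (row_col_orbit A3) = 9"
  "card (row_col_orbit A4) = 3" "card (row_col_orbit A5) = 3"
  unfolding representatives_as_outer_sums
  by (simp_all add: card_row_col_orbit_spikes card_range_spike range_spike_const)

section \<open>Classification and count\<close>

lemma weight_sum_2_cases:
  assumes "weight a + weight b = 2"
  obtains "a \<in> range (spike 2 0)" "b \<in> range (spike 0 0)"
    | "a \<in> range (spike 0 1)" "b \<in> range (spike 0 0)"
    | "a \<in> range (spike 1 0)" "b \<in> range (spike 1 0)"
    | "a \<in> range (spike 0 0)" "b \<in> range (spike 2 0)"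
    | "a \<in> range (spike 0 0)" "b \<in> range (spike 0 1)"
proof -
  from assms consider "weight a = 2" "weight b = 0" | "weight a = 1" "weight b = 1"
    | "weight a = 0" "weight b = 2" by linarith
  then show thesis
    unfolding weight_eq_0_iff weight_eq_1_iff weight_eq_2_iff using that by cases blast+
qed

lemma outer_sum_in_orbit_of_representative:
  assumes "weight a + weight b = 2"
  shows "\<exists>A\<in>{A1, A2, A3, A4, A5}. outer_sum a b \<in> row_col_orbit A"
  using assms
  by (cases rule: weight_sum_2_cases)
    (simp_all only: representatives_as_outer_sums row_col_orbit_spikes bex_simps, blast+)

text \<open>
  The row sums are \<open>3 * a $ i + weight b\<close>, so they form a spike whenever \<open>a\<close> does;
  the values of the spike depend on the weight of \<open>b\<close>.
\<close>

lemma row_sums_of_outer_sum: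
  assumes "weight a + weight b = 2"
  shows "\<exists>w\<in>{vector [6, 0, 0], vector [3, 3, 0], vector [4, 1, 1], vector [2, 2, 2]}.
    vec_perm (\<chi> i. row_sum (outer_sum a b) i) w"
proof -
  have vectors: "vector [6, 0, 0] = spike 6 0 1" "vector [3, 3, 0] = spike 0 3 3"
    "vector [4, 1, 1] = spike 4 1 1" "vector [2, 2, 2] = spike 2 2 1"
    by (simp_all add: vec3_eq_iff spike_def)
  have rows: "(\<chi> i. row_sum (outer_sum (spike x y k) c) i) =
      spike (3 * x + weight c) (3 * y + weight c) k" for x y k c
    by (simp add: vec_eq_iff row_sum_outer_sum spike_def)
  show ?thesis
    using assms unfolding vectors
    by (cases rule: weight_sum_2_cases)
      (auto simp: rows vec_perm_spike_iff weight_spike numeral_2_eq_2)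
qed

lemma card_admissible: "card {M. admissible M} = 21"
proof -
  let ?V = "\<lambda>s. {v. weight v = s}"
  let ?P = "?V 2 \<times> ?V 0 \<union> ?V 1 \<times> ?V 1 \<union> ?V 0 \<times> ?V 2"
  have P: "?P = {(a, b). weight a + weight b = 2}" by auto
  have fin: "finite (?V 0)" "finite (?V 1)" "finite (?V 2)"
    using card_weight_le_2 by (simp_all add: card_ge_0_finite)
  have "card ?P = 6 * 1 + 3 * 3 + 1 * 6"
    using fin by (subst card_Un_disjoint; (subst card_Un_disjoint)?)
      (auto simp: card_cartesian_product card_weight_le_2[simplified])
  moreover have "{M. admissible M} = (\<lambda>(a, b). outer_sum a b) ` ?P"
    unfolding P by (auto simp: admissible_iff_outer_sum image_iff)
  moreover have "inj_on (\<lambda>(a, b). outer_sum a b) ?P"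
    by (rule inj_on_subset[OF inj_on_outer_sum]) auto
  ultimately show ?thesis by (simp add: card_image)
qed

theorem theorem3p2:
  shows "(\<forall>M. admissible M \<longrightarrow>
            (\<forall>i j. real (M $ i $ j) = (real (row_sum M i) + real (col_sum M j) - 2) / 3) \<and>
            (\<forall>i i'. [row_sum M i = row_sum M i'] (mod 3)) \<and>
            (\<forall>j j'. [col_sum M j = col_sum M j'] (mod 3)) \<and>
            (\<exists>A\<in>{A1, A2, A3, A4, A5}. M \<in> row_col_orbit A) \<and>
            (\<exists>w\<in>{vector [6, 0, 0], vector [3, 3, 0], vector [4, 1, 1], vector [2, 2, 2]}.
               vec_perm (\<chi> i. row_sum M i) w)) \<and>
         card (row_col_orbit A1) = 3 \<and>
         card (row_col_orbit A2) = 3 \<and>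
         card (row_col_orbit A3) = 9 \<and>
         card (row_col_orbit A4) = 3 \<and>
         card (row_col_orbit A5) = 3 \<and>
         card {M. admissible M} = 21"
proof -
  have "(\<forall>i j. real (M $ i $ j) = (real (row_sum M i) + real (col_sum M j) - 2) / 3) \<and>
      (\<forall>i i'. [row_sum M i = row_sum M i'] (mod 3)) \<and>
      (\<forall>j j'. [col_sum M j = col_sum M j'] (mod 3)) \<and>
      (\<exists>A\<in>{A1, A2, A3, A4, A5}. M \<in> row_col_orbit A) \<and>
      (\<exists>w\<in>{vector [6, 0, 0], vector [3, 3, 0], vector [4, 1, 1], vector [2, 2, 2]}.
         vec_perm (\<chi> i. row_sum M i) w)"
    if adm: "admissible M" for M
  proof -
    from adm obtain a b where w: "weight a + weight b = 2" and M: "M = outer_sum a b"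
      unfolding admissible_iff_outer_sum by blast
    have "real (weight a) + real (weight b) = 2"
      using w by linarith
    then have "real (M $ i $ j) = (real (row_sum M i) + real (col_sum M j) - 2) / 3" for i j
      by (simp add: M row_sum_outer_sum col_sum_outer_sum field_simps)
    moreover have "[row_sum M i = row_sum M i'] (mod 3)" "[col_sum M i = col_sum M i'] (mod 3)"
      for i i'
      by (simp_all add: M row_sum_outer_sum col_sum_outer_sum cong_def)
    ultimately show ?thesis
      using outer_sum_in_orbit_of_representative[OF w] row_sums_of_outer_sum[OF w]
      unfolding M by blast
  qed
  then show ?thesis
    using card_orbits_of_representatives card_admissible by blast
qed

end
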